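(* Let $\mathcal{D}$ be a class of digraphs, and let $\mathcal{D}^{subst}$ be its closure under substitution. (1) If $\mathcal{D}$ is a class of tournaments that is $\vec{\chi}$-bounded by a function $f$, then $\mathcal{D}^{subst}$ is $\vec{\chi}$-bounded by the function $g(w) = (3wf(w))^w$. (2) If there exists $K$ such that for every digraph $D$ in $\mathcal{D}$ the underlying graph of $D$ has chromatic number at most $K$, then $\mathcal{D}^{subst}$ is $\vec{\chi}$-bounded by the function $g(w) = (3K)^w$.
   Context: All graphs and digraphs are finite, with no loops, no parallel edges or arcs, and no anti-parallel arcs (so no directed cycle of length 2). A tournament is an orientation of a complete graph. A class of digraphs is a set of digraphs closed under taking induced subdigraphs (and isomorphism). The dichromatic number $\vec{\chi}(D)$ of a digraph $D$ is the least $k$ such that $V(D)$ can be partitioned into $k$ sets each inducing an acyclic subdigraph. For a total ordering $\prec$ of $V(D)$, the backedge graph $D^{\prec}$ is the undirected graph with vertex set $V(D)$ in which, for $u\prec v$, $uv$ is an edge if and only if $vu\in A(D)$. The clique number of $D$ is $\vec{\omega}(D)=\min\{\omega(D^{\prec}) : \prec \text{ a total ordering of } V(D)\}$, where $\omega$ is the usual clique number of an undirected graph. A class $\mathcal{C}$ of digraphs is $\vec{\chi}$-bounded by a function $f$ if $f$ is increasing and $\vec{\chi}(D)\le f(\vec{\omega}(D))$ for every $D\in\mathcal{C}$. Substitution: given digraphs $D_1,D_2$ with disjoint vertex sets and $u\in V(D_1)$, the digraph $D$ obtained by substituting $D_2$ for $u$ in $D_1$ has vertex set $(V(D_1)\setminus\{u\})\cup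 V(D_2)$, satisfies $D[V(D_1)\setminus \{u\}]=D_1\setminus u$ and $D[V(D_2)]=D_2$, and for every $v\in V(D_1)\setminus\{u\}$: if $vu\in A(D_1)$ then all arcs from $v$ to $V(D_2)$ are present; if $uv\in A(D_1)$ then all arcs from $V(D_2)$ to $v$ are present; if $u,v$ are non-adjacent in $D_1$ then there is no arc between $v$ and $V(D_2)$. $\mathcal{D}^{subst}$ denotes the closure of $\mathcal{D}$ under substitution, i.e. the smallest set of digraphs containing $\mathcal{D}$ and closed under substitution. *)

theory Defs
  imports
    "Graph_Theory.Pair_Digraph"
    "Graph_Theory.Digraph_Component"
    "Graph_Theory.Digraph_Isomorphism"
    "HOL-Library.Disjoint_Sets"
    "HOL-Library.Infinite_Typeclass"
    "HOL-Library.Ramsey"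
begin

text \<open>
  Undirected graphs are given by a vertex set and a set of two-element edges;
  \<^const>\<open>clique\<close> is the one of \<^theory>\<open>HOL-Library.Ramsey\<close>.
\<close>

definition clique_number :: "'a set \<Rightarrow> 'a set set \<Rightarrow> nat" where
  "clique_number V E = Max (card ` {S. S \<subseteq> V \<and> clique S E})"

definition chromatic_number :: "'a set \<Rightarrow> 'a set set \<Rightarrow> nat" where
  "chromatic_number V E =
     (LEAST k. \<exists>c. c ` V \<subseteq> {..<k} \<and> (\<forall>u\<in>V. \<forall>v\<in>V. {u, v} \<in> E \<longrightarrow> c u \<noteq> c v))"

text \<open>
  Loops and parallel arcs are already excluded by \<^locale>\<open>pair_digraph\<close>, which also gives
  finiteness. The digraph with no vertices is allowed.
\<close>

locale oriented_digraph = pair_digraph +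
  assumes no_antiparallel: "(u, v) \<in> parcs G \<Longrightarrow> (v, u) \<notin> parcs G"

locale tournament = oriented_digraph +
  assumes adjacent:
    "u \<in> pverts G \<Longrightarrow> v \<in> pverts G \<Longrightarrow> u \<noteq> v \<Longrightarrow> (u, v) \<in> parcs G \<or> (v, u) \<in> parcs G"

definition underlying_edges :: "'a pair_pre_digraph \<Rightarrow> 'a set set" where
  "underlying_edges D = {{u, v} | u v. (u, v) \<in> parcs D}"

definition acyclic_digraph :: "('a, 'b) pre_digraph \<Rightarrow> bool" where
  "acyclic_digraph D \<longleftrightarrow> \<not> (\<exists>p. pre_digraph.cycle D p)"

definition dichromatic_number :: "'a pair_pre_digraph \<Rightarrow> nat" where
  "dichromatic_number D =
     (LEAST k. \<exists>P. partition_on (pverts D) P \<and> card P = k \<and>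
        (\<forall>S\<in>P. acyclic_digraph (with_proj D \<restriction> S)))"

text \<open>Orders are reflexive: \<open>(u, v) \<in> r\<close> and \<open>u \<noteq> v\<close> says that \<open>u\<close> strictly precedes \<open>v\<close>.\<close>

definition backedges :: "'a pair_pre_digraph \<Rightarrow> 'a rel \<Rightarrow> 'a set set" where
  "backedges D r = {{u, v} | u v. (u, v) \<in> r \<and> u \<noteq> v \<and> (v, u) \<in> parcs D}"

definition digraph_clique_number :: "'a pair_pre_digraph \<Rightarrow> nat" where
  "digraph_clique_number D =
     Min ((\<lambda>r. clique_number (pverts D) (backedges D r)) ` {r. linear_order_on (pverts D) r})"

text \<open>
  The vertices are taken from a fixed type. Over an infinite type every finite digraph has an
  isomorphic copy, and any two digraphs have disjoint isomorphic copies.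
\<close>

definition digraph_class :: "'a pair_pre_digraph set \<Rightarrow> bool" where
  "digraph_class \<D> \<longleftrightarrow>
     (\<forall>D\<in>\<D>. oriented_digraph D) \<and>
     (\<forall>D\<in>\<D>. \<forall>H. induced_subgraph (with_proj H) (with_proj D) \<longrightarrow> H \<in> \<D>) \<and>
     (\<forall>D\<in>\<D>. \<forall>H. digraph_iso (with_proj D) (with_proj H) \<longrightarrow> H \<in> \<D>)"

text \<open>
  Increasing is meant in the weak sense and on the positive integers: only the digraph without
  vertices has clique number \<open>0\<close>, and with the convention \<open>0 ^ 0 = 1\<close> a bounding function
  such as \<open>\<lambda>w. (3 * K) ^ w\<close> with \<open>K = 0\<close> takes the value \<open>1\<close> there and \<open>0\<close> everywhere else.
\<close>

definition dichi_bounded_by :: "'a pair_pre_digraph set \<Rightarrow> (nat \<Rightarrow> nat) \<Rightarrow> bool" where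
  "dichi_bounded_by \<C> f \<longleftrightarrow>
     mono_on {1..} f \<and> (\<forall>D\<in>\<C>. dichromatic_number D \<le> f (digraph_clique_number D))"

definition substitute ::
  "'a pair_pre_digraph \<Rightarrow> 'a \<Rightarrow> 'a pair_pre_digraph \<Rightarrow> 'a pair_pre_digraph" where
  "substitute D1 u D2 =
     \<lparr> pverts = (pverts D1 - {u}) \<union> pverts D2,
       parcs = {(v, w) \<in> parcs D1. v \<noteq> u \<and> w \<noteq> u} \<union> parcs D2 \<union>
               {(v, x) | v x. (v, u) \<in> parcs D1 \<and> x \<in> pverts D2} \<union>
               {(x, v) | x v. (u, v) \<in> parcs D1 \<and> x \<in> pverts D2} \<rparr>"

inductive_set subst_closure :: "'a pair_pre_digraph set \<Rightarrow> 'a pair_pre_digraph set"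
  for \<D> :: "'a pair_pre_digraph set" where
  base: "D \<in> \<D> \<Longrightarrow> D \<in> subst_closure \<D>"
| subst: "\<lbrakk>D1 \<in> subst_closure \<D>; D2 \<in> subst_closure \<D>;
     pverts D1 \<inter> pverts D2 = {}; u \<in> pverts D1\<rbrakk>
   \<Longrightarrow> substitute D1 u D2 \<in> subst_closure \<D>"

end

theory Submission
  imports Defs
begin

text \<open>
  Why the theorem holds. A digraph built by substitutions is either trivial or splits into
  parts that are homogeneous towards each other, the quotient being a member of the original
  class. Fix an ordering of the vertices whose backedge graph has clique number \<open>w\<close>, and call a
  clique of that graph a back-clique. In both statements, members of the class whose
  back-cliques have size at most \<open>w\<close> can be coloured with \<open>k\<close> colours so that no backedge is
  monochromatic: \<open>k = K\<close> works in the second statement, since even the underlying graph is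
  properly coloured, and \<open>k = w * f w\<close> works in the first, since an acyclic set of vertices of a
  tournament is transitive, so that labelling each vertex with the size of the largest back-clique
  ending there splits it into \<open>w\<close> sets without backedges (\<open>acyclic_coloring_refinement\<close>).

  Let \<open>g = (2 * k) ^ (w - 1)\<close>; by induction on \<open>w\<close> every set of vertices with back-cliques of size
  less than \<open>w\<close> is \<open>g\<close>-dicolourable. Call a part cheap if it is \<open>2 * g\<close>-dicolourable. A part that
  is not cheap behaves like a single vertex of the ordering (\<open>threshold_position\<close>): it has a vertex
  \<open>p\<close> such that all outside in-neighbours of the part come before \<open>p\<close> and all outside
  out-neighbours come after \<open>p\<close>. Indeed, let \<open>p\<close> be the first vertex at which the initial segment
  of the part has a back-clique of size \<open>w\<close>. An in-neighbour \<open>z\<close> after \<open>p\<close> would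
  extend that back-clique. An out-neighbour \<open>z\<close> before \<open>p\<close> would split the part into the vertices
  before \<open>z\<close>, which contain no back-clique of size \<open>w\<close> by the choice of \<open>p\<close>, and those after \<open>z\<close>,
  which contain none because \<open>z\<close> extends it; so \<open>g + g\<close> colours would suffice for the part.

  Now colour the parts that are not cheap recursively, each with all \<open>2 * k * g\<close> colours, and
  colour each cheap part by pairs consisting of the colour of the part among the \<open>k\<close> colours of the
  quotient and one of its \<open>2 * g\<close> own colours. A monochromatic arc between different parts always
  goes forward between the representatives of the parts, so monochromatic cycles stay within one
  part and do not exist (\<open>dicolorable_parts\<close>). The recursion costs nothing
  because parts that are not cheap reuse the whole palette. The result is the bound
  \<open>(2 * k) ^ w \<le> (3 * k) ^ w\<close>.
\<close>

section \<open>Colourings and back-cliques of arc sets\<close>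

definition mono_arcs :: "'a rel \<Rightarrow> 'a set \<Rightarrow> ('a \<Rightarrow> nat) \<Rightarrow> 'a rel" where
  "mono_arcs E X c = {(x, y) \<in> E. x \<in> X \<and> y \<in> X \<and> c x = c y}"

definition dicolorable :: "'a rel \<Rightarrow> 'a set \<Rightarrow> nat \<Rightarrow> bool" where
  "dicolorable E X n \<longleftrightarrow> (\<exists>c. c ` X \<subseteq> {..<n} \<and> acyclic (mono_arcs E X c))"

text \<open>
  Vertices are ordered by an injective \<open>pos\<close>; back-cliques are the cliques of the backedge graph
  of that ordering, and \<open>back_cliques_le\<close> bounds the clique number of the backedge graph on \<open>X\<close>.
\<close>

definition back_clique :: "'a rel \<Rightarrow> ('a \<Rightarrow> nat) \<Rightarrow> 'a set \<Rightarrow> bool" where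
  "back_clique E pos C \<longleftrightarrow> (\<forall>x\<in>C. \<forall>y\<in>C. pos x < pos y \<longrightarrow> (y, x) \<in> E)"

definition back_cliques_le :: "'a rel \<Rightarrow> ('a \<Rightarrow> nat) \<Rightarrow> 'a set \<Rightarrow> nat \<Rightarrow> bool" where
  "back_cliques_le E pos X w \<longleftrightarrow> (\<forall>C\<subseteq>X. back_clique E pos C \<longrightarrow> card C \<le> w)"

lemma back_cliques_le_mono:
  "back_cliques_le E pos X w \<Longrightarrow> Y \<subseteq> X \<Longrightarrow> w \<le> w' \<Longrightarrow> back_cliques_le E pos Y w'"
  unfolding back_cliques_le_def by (meson order_trans)

lemma dicolorable_mono: "dicolorable E X n \<Longrightarrow> n \<le> m \<Longrightarrow> dicolorable E X m"
  unfolding dicolorable_def by (meson lessThan_subset_iff order_trans)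

lemma dicolorable_empty: "dicolorable E {} n"
  unfolding dicolorable_def by (auto simp: mono_arcs_def acyclic_def)

lemma dicolorable_singleton:
  assumes "(x, x) \<notin> E" "0 < n"
  shows "dicolorable E {x} n"
proof -
  have "mono_arcs E {x} (\<lambda>_. 0) = {}" using assms(1) by (auto simp: mono_arcs_def)
  then show ?thesis
    unfolding dicolorable_def using assms(2) by (intro exI[of _ "\<lambda>_. 0"]) (auto simp: acyclic_def)
qed

text \<open>
  A cycle must stay within one block, since leaving a block raises the height \<open>h\<close> and no arc
  lowers it again.
\<close>

lemma acyclic_blocks:
  fixes q :: "'a \<Rightarrow> 'b" and h :: "'b \<Rightarrow> nat"
  assumes between: "\<And>x y. (x, y) \<in> M \<Longrightarrow> q x \<noteq> q y \<Longrightarrow> h (q x) < h (q y)"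
    and inside: "\<And>t. acyclic {(x, y) \<in> M. q x = t \<and> q y = t}"
  shows "acyclic M"
proof -
  have main: "h (q x) < h (q y) \<or> q x = q y \<and> (x, y) \<in> {(x', y') \<in> M. q x' = q x \<and> q y' = q x}\<^sup>+"
    if "(x, y) \<in> M\<^sup>+" for x y
    using that
  proof (induction rule: trancl_induct)
    case (base y)
    then show ?case using between[of x y] by (cases "q x = q y") auto
  next
    case (step y z)
    show ?case
    proof (cases "q y = q z")
      case True
      from step.IH show ?thesis
      proof
        assume "h (q x) < h (q y)"
        then show ?thesis using True by simp
      next
        assume a: "q x = q y \<and> (x, y) \<in> {(x', y') \<in> M. q x' = q x \<and> q y' = q x}\<^sup>+"
        then have "(y, z) \<in> {(x', y') \<in> M. q x' = q x \<and> q y' = q x}"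
          using step.hyps True by simp
        then show ?thesis using a True by (metis (no_types, lifting) trancl.trancl_into_trancl)
      qed
    next
      case False
      then have "h (q y) < h (q z)" using between step.hyps by blast
      then show ?thesis using step.IH by auto
    qed
  qed
  show ?thesis
    unfolding acyclic_def
  proof (intro allI notI)
    fix x assume "(x, x) \<in> M\<^sup>+"
    from main[OF this] have "(x, x) \<in> {(x', y') \<in> M. q x' = q x \<and> q y' = q x}\<^sup>+" by simp
    then show False using inside[of "q x"] unfolding acyclic_def by blast
  qed
qed

lemma dicolorable_Un:
  assumes "dicolorable E X m" "dicolorable E Y n" "Z \<subseteq> X \<union> Y"
  shows "dicolorable E Z (m + n)"
proof -
  obtain c where c: "c ` X \<subseteq> {..<m}" "acyclic (mono_arcs E X c)"
    using assms unfolding dicolorable_def by blast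
  obtain d where d: "d ` Y \<subseteq> {..<n}" "acyclic (mono_arcs E Y d)"
    using assms unfolding dicolorable_def by blast
  define e where "e = (\<lambda>x. if x \<in> X then c x else m + d x)"
  have cX: "\<And>x. x \<in> X \<Longrightarrow> c x < m" and dY: "\<And>x. x \<in> Y \<Longrightarrow> d x < n" using c d by auto
  have "acyclic (mono_arcs E Z e)"
  proof (rule acyclic_blocks[where q = "\<lambda>x. x \<in> X" and h = "\<lambda>_. 0"])
    fix x y assume "(x, y) \<in> mono_arcs E Z e" "(x \<in> X) \<noteq> (y \<in> X)"
    then show "(0::nat) < 0"
      using cX[of x] cX[of y] assms(3) by (auto simp: mono_arcs_def e_def split: if_splits)
  next
    fix t show "acyclic {(x, y) \<in> mono_arcs E Z e. (x \<in> X) = t \<and> (y \<in> X) = t}"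
    proof (cases t)
      case True
      then show ?thesis
        by (intro acyclic_subset[OF c(2)]) (auto simp: mono_arcs_def e_def)
    next
      case False
      then show ?thesis
        using assms(3) by (intro acyclic_subset[OF d(2)]) (auto simp: mono_arcs_def e_def)
    qed
  qed
  moreover have "e ` Z \<subseteq> {..<m + n}"
    using cX dY assms(3) by (force simp: e_def)
  ultimately show ?thesis unfolding dicolorable_def by blast
qed

section \<open>Decompositions into homogeneous parts\<close>

definition restr :: "'a rel \<Rightarrow> 'a set \<Rightarrow> 'a pair_pre_digraph" where
  "restr E T = \<lparr>pverts = T, parcs = E \<inter> T \<times> T\<rparr>"

text \<open>
  The labelling \<open>q\<close> of the vertices describes both the parts (its fibres) and the quotient, which is
  represented by the sets \<open>T\<close> that meet each part at most once. Requiring all these partial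
  transversals to induce members of the class, instead of one full transversal, makes
  decomposability visibly hereditary: subsets keep the same labelling.
\<close>

inductive decomposable :: "'a pair_pre_digraph set \<Rightarrow> 'a rel \<Rightarrow> 'a set \<Rightarrow> bool"
  for \<D> E where
  empty: "decomposable \<D> E {}"
| singleton: "restr E {x} \<in> \<D> \<Longrightarrow> (x, x) \<notin> E \<Longrightarrow> decomposable \<D> E {x}"
| parts: "(\<And>T. T \<subseteq> X \<Longrightarrow> inj_on q T \<Longrightarrow> restr E T \<in> \<D>) \<Longrightarrow>
    (\<And>x y x' y'. x \<in> X \<Longrightarrow> y \<in> X \<Longrightarrow> x' \<in> X \<Longrightarrow> y' \<in> X \<Longrightarrow>
       q x = q x' \<Longrightarrow> q y = q y' \<Longrightarrow> q x \<noteq> q y \<Longrightarrow> (x, y) \<in> E \<Longrightarrow> (x', y') \<in> E) \<Longrightarrow>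
    (\<And>t. decomposable \<D> E {x \<in> X. (q :: 'a \<Rightarrow> 'a) x = t}) \<Longrightarrow> decomposable \<D> E X"

lemma decomposable_subset:
  "decomposable \<D> E X \<Longrightarrow> Y \<subseteq> X \<Longrightarrow> decomposable \<D> E Y"
proof (induction arbitrary: Y rule: decomposable.induct)
  case empty
  then show ?case by (simp add: decomposable.empty)
next
  case (singleton x)
  then have "Y = {} \<or> Y = {x}" by auto
  then show ?case
    using decomposable.empty decomposable.singleton[OF singleton.hyps] by blast
next
  case (parts X q)
  show ?case
  proof (rule decomposable.parts[where q = q])
    show "decomposable \<D> E {x \<in> Y. q x = t}" for t
      using parts.prems by (intro parts.IH[of _ t]) auto
    show "restr E T \<in> \<D>" if "T \<subseteq> Y" "inj_on q T" for T
      using parts.hyps(1)[of T] that parts.prems by blast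
    show "(x', y') \<in> E"
      if "x \<in> Y" "y \<in> Y" "x' \<in> Y" "y' \<in> Y" "q x = q x'" "q y = q y'" "q x \<noteq> q y" "(x, y) \<in> E"
      for x y x' y'
      using parts.hyps(2)[of x y x' y'] that parts.prems by blast
  qed
qed

lemma decomposable_cong:
  "decomposable \<D> E X \<Longrightarrow> E \<inter> X \<times> X = E' \<inter> X \<times> X \<Longrightarrow> decomposable \<D> E' X"
proof (induction rule: decomposable.induct)
  case empty
  then show ?case by (simp add: decomposable.empty)
next
  case (singleton x)
  then show ?case by (intro decomposable.singleton) (auto simp: restr_def)
next
  case (parts X q)
  have iff: "(x, y) \<in> E \<longleftrightarrow> (x, y) \<in> E'" if "x \<in> X" "y \<in> X" for x y
    using parts.prems that by blast
  show ?case
  proof (rule decomposable.parts[where q = q])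
    show "decomposable \<D> E' {x \<in> X. q x = t}" for t
      using parts.prems by (intro parts.IH[of t]) auto
    show "restr E' T \<in> \<D>" if "T \<subseteq> X" "inj_on q T" for T
    proof -
      have "E \<inter> T \<times> T = E' \<inter> T \<times> T" using iff that by auto
      then show ?thesis using parts.hyps(1)[OF that] by (simp add: restr_def)
    qed
    show "(x', y') \<in> E'"
      if "x \<in> X" "y \<in> X" "x' \<in> X" "y' \<in> X" "q x = q x'" "q y = q y'" "q x \<noteq> q y" "(x, y) \<in> E'"
      for x y x' y'
      using parts.hyps(2)[of x y x' y'] that iff by blast
  qed
qed

lemma decomposable_no_loop: "decomposable \<D> E X \<Longrightarrow> x \<in> X \<Longrightarrow> (x, x) \<notin> E"
  by (induction rule: decomposable.induct) auto

lemma decomposable_vertex: "decomposable \<D> E X \<Longrightarrow> x \<in> X \<Longrightarrow> restr E {x} \<in> \<D>"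
  by (induction rule: decomposable.induct) auto

text \<open>
  Decompositions compose: if \<open>Y\<close> arises from \<open>X\<close> by replacing each vertex \<open>v\<close> by the fibre of \<open>\<sigma>\<close>
  over \<open>v\<close>, every labelling \<open>q\<close> in the decomposition of \<open>X\<close> pulls back to \<open>q \<circ> \<sigma>\<close>, and transversals
  of the pulled back labelling are isomorphic copies of transversals of \<open>q\<close>. Allowing all vertices
  to be replaced at once keeps the induction uniform; a substitution replaces only one.
\<close>

lemma decomposable_blow_up:
  assumes iso: "\<And>D H. D \<in> \<D> \<Longrightarrow> digraph_iso (with_proj D) (with_proj H) \<Longrightarrow> H \<in> \<D>"
  shows "decomposable \<D> E X \<Longrightarrow> \<sigma> ` Y \<subseteq> X \<Longrightarrow>
    (\<And>x y. x \<in> Y \<Longrightarrow> y \<in> Y \<Longrightarrow> \<sigma> x \<noteq> \<sigma> y \<Longrightarrow> (x, y) \<in> E' \<longleftrightarrow> (\<sigma> x, \<sigma> y) \<in> E) \<Longrightarrow>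
    (\<And>v. v \<in> X \<Longrightarrow> decomposable \<D> E' {y \<in> Y. \<sigma> y = v}) \<Longrightarrow> decomposable \<D> E' Y"
proof (induction arbitrary: Y rule: decomposable.induct)
  case empty
  then show ?case by (simp add: decomposable.empty)
next
  case (singleton v)
  then have "{y \<in> Y. \<sigma> y = v} = Y" by auto
  then show ?case using singleton.prems(3)[of v] by simp
next
  case (parts X q)
  have X: "\<sigma> y \<in> X" if "y \<in> Y" for y using parts.prems(1) that by blast
  show ?case
  proof (rule decomposable.parts[where q = "\<lambda>y. q (\<sigma> y)"])
    show "decomposable \<D> E' {y \<in> Y. q (\<sigma> y) = t}" for t
    proof (rule parts.IH[of _ t])
      show "decomposable \<D> E' {y \<in> {y \<in> Y. q (\<sigma> y) = t}. \<sigma> y = v}"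
        if "v \<in> {x \<in> X. q x = t}" for v
      proof (rule decomposable_subset)
        show "decomposable \<D> E' {y \<in> Y. \<sigma> y = v}" using parts.prems(3) that by blast
      qed auto
    qed (use parts.prems X in auto)
    show "(x', y') \<in> E'"
      if "x \<in> Y" "y \<in> Y" "x' \<in> Y" "y' \<in> Y" "q (\<sigma> x) = q (\<sigma> x')" "q (\<sigma> y) = q (\<sigma> y')"
        "q (\<sigma> x) \<noteq> q (\<sigma> y)" "(x, y) \<in> E'" for x y x' y'
    proof -
      have ne: "\<sigma> x \<noteq> \<sigma> y" "\<sigma> x' \<noteq> \<sigma> y'" using that by auto
      have "(\<sigma> x, \<sigma> y) \<in> E" using parts.prems(2)[of x y] that ne by blast
      then have "(\<sigma> x', \<sigma> y') \<in> E"
        using parts.hyps(2)[of "\<sigma> x" "\<sigma> y" "\<sigma> x'" "\<sigma> y'"] that X by blast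
      then show ?thesis using parts.prems(2)[of x' y'] that ne by blast
    qed
    show "restr E' T \<in> \<D>" if T: "T \<subseteq> Y" "inj_on (\<lambda>y. q (\<sigma> y)) T" for T
    proof -
      have inj: "inj_on \<sigma> T" using T(2) by (auto simp: inj_on_def)
      have "\<sigma> ` T \<subseteq> X" "inj_on q (\<sigma> ` T)" using T X by (auto simp: inj_on_def)
      then have mem: "restr E (\<sigma> ` T) \<in> \<D>" by (rule parts.hyps(1))
      have dE: "decomposable \<D> E X" by (rule decomposable.parts[of X q]) (use parts.hyps in blast)+
      have loop: "(y, y) \<notin> E'" if "y \<in> T" for y
        using decomposable_no_loop[OF parts.prems(3)[of "\<sigma> y"], of y] X[of y] that T(1) by blast
      have loop': "(\<sigma> y, \<sigma> y) \<notin> E" if "y \<in> T" for y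
        using decomposable_no_loop[OF dE] X[of y] that T(1) by blast
      have arc: "(x, y) \<in> E' \<longleftrightarrow> (\<sigma> x, \<sigma> y) \<in> E" if "x \<in> T" "y \<in> T" for x y
      proof (cases "x = y")
        case True
        then show ?thesis using loop loop' that by blast
      next
        case False
        then have "\<sigma> x \<noteq> \<sigma> y" using inj that by (auto dest: inj_onD)
        then show ?thesis using parts.prems(2)[of x y] that T(1) by blast
      qed
      define h where "h = the_inv_into T \<sigma>"
      have h: "h (\<sigma> y) = y" if "y \<in> T" for y
        unfolding h_def using inj that by (rule the_inv_into_f_f)
      define f where "f = \<lparr>iso_verts = h, iso_arcs = map_prod h h, iso_head = snd, iso_tail = fst\<rparr>"
      have hinj: "inj_on h (\<sigma> ` T)" using h by (auto simp: inj_on_def)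
      have "pre_digraph.digraph_isomorphism (with_proj (restr E (\<sigma> ` T))) f"
        unfolding pre_digraph.digraph_isomorphism_def f_def restr_def
      proof (intro conjI, goal_cases)
        case 1
        show ?case by unfold_locales auto
      next
        case 2
        then show ?case using hinj by simp
      next
        case 3
        then show ?case
          by (simp, rule inj_on_subset[OF map_prod_inj_on[OF hinj hinj]]) auto
      qed auto
      moreover have "with_proj (restr E' T) = app_iso f (with_proj (restr E (\<sigma> ` T)))"
      proof -
        have "h ` \<sigma> ` T = T" using h by force
        moreover have "E' \<inter> T \<times> T = map_prod h h ` (E \<inter> \<sigma> ` T \<times> \<sigma> ` T)" (is "?L = ?R")
        proof
          show "?L \<subseteq> ?R"
          proof
            fix p assume "p \<in> ?L"
            then obtain x y where p: "p = (x, y)" "x \<in> T" "y \<in> T" "(x, y) \<in> E'" by auto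
            then have "(\<sigma> x, \<sigma> y) \<in> E \<inter> \<sigma> ` T \<times> \<sigma> ` T" using arc by auto
            moreover have "p = map_prod h h (\<sigma> x, \<sigma> y)" using p h by simp
            ultimately show "p \<in> ?R" by blast
          qed
          show "?R \<subseteq> ?L" using arc h by auto
        qed
        ultimately show ?thesis
          by (simp add: with_proj_def app_iso_def f_def restr_def)
      qed
      ultimately have "digraph_iso (with_proj (restr E (\<sigma> ` T))) (with_proj (restr E' T))"
        unfolding digraph_iso_def by blast
      then show ?thesis using iso mem by blast
    qed
  qed
qed

section \<open>Colouring decomposable digraphs\<close>

text \<open>
  The key step. A homogeneous set \<open>Y\<close> that needs more than \<open>2 * g\<close> colours has a vertex \<open>p\<close> whose
  position separates its in-neighbours from its out-neighbours, so that for acyclicity \<open>Y\<close> can be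
  treated as if it were the single vertex \<open>p\<close>. The vertex \<open>p\<close> is the first one at which \<open>Y\<close> has
  seen a back-clique with more than \<open>w\<close> vertices.
\<close>

lemma threshold_position:
  assumes X: "finite X" "inj_on pos X" "Y \<subseteq> X"
    and w: "back_cliques_le E pos X (Suc w)"
    and hom: "\<And>z y y'. z \<in> X - Y \<Longrightarrow> y \<in> Y \<Longrightarrow> y' \<in> Y \<Longrightarrow> (z, y) \<in> E \<Longrightarrow> (z, y') \<in> E"
      "\<And>z y y'. z \<in> X - Y \<Longrightarrow> y \<in> Y \<Longrightarrow> y' \<in> Y \<Longrightarrow> (y, z) \<in> E \<Longrightarrow> (y', z) \<in> E"
    and smaller: "\<And>Z. Z \<subseteq> Y \<Longrightarrow> back_cliques_le E pos Z w \<Longrightarrow> dicolorable E Z g"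
    and not: "\<not> dicolorable E Y (2 * g)"
  shows "\<exists>p\<in>Y. \<forall>z\<in>X - Y. \<forall>y\<in>Y. ((z, y) \<in> E \<longrightarrow> pos z < pos p) \<and> ((y, z) \<in> E \<longrightarrow> pos p < pos z)"
proof -
  have finC: "finite C" if "C \<subseteq> Y" for C using that X(1,3) by (meson finite_subset)
  \<comment> \<open>A vertex joined to all of \<open>Z\<close> by backedges uses up one vertex of the largest back-clique.\<close>
  have ext: "back_cliques_le E pos Z w"
    if "Z \<subseteq> Y" "z \<in> X - Y"
      and arcs: "\<And>y. y \<in> Z \<Longrightarrow> (pos z < pos y \<longrightarrow> (y, z) \<in> E) \<and> (pos y < pos z \<longrightarrow> (z, y) \<in> E)" for Z z
    unfolding back_cliques_le_def
  proof (intro allI impI)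
    fix C assume C: "C \<subseteq> Z" "back_clique E pos C"
    then have "back_clique E pos (insert z C)"
      using arcs unfolding back_clique_def by auto
    moreover have "insert z C \<subseteq> X" using C that X by blast
    ultimately have "card (insert z C) \<le> Suc w" using w unfolding back_cliques_le_def by blast
    moreover have "z \<notin> C" "finite C" using C that finC[of C] by auto
    ultimately show "card C \<le> w" by simp
  qed
  define big where "big x \<longleftrightarrow> x \<in> Y \<and> \<not> back_cliques_le E pos {y \<in> Y. pos y \<le> pos x} w" for x
  have big_max: "\<exists>x\<in>C. big x" if C: "C \<subseteq> Y" "back_clique E pos C" "w < card C" for C
  proof -
    have "C \<noteq> {}" using C(3) by auto
    then have "Max (pos ` C) \<in> pos ` C" using finC[OF C(1)] by auto
    then obtain x where x: "x \<in> C" "pos x = Max (pos ` C)" by (metis imageE)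
    then have "\<forall>y\<in>C. pos y \<le> pos x" using finC[OF C(1)] by simp
    then have "C \<subseteq> {y \<in> Y. pos y \<le> pos x}" using C by auto
    then have "big x" unfolding big_def back_cliques_le_def using C x by (meson leD subsetD)
    then show ?thesis using x by blast
  qed
  have "\<not> back_cliques_le E pos Y w"
    using smaller[of Y] not dicolorable_mono[of E Y g "2 * g"] by auto
  then have "\<exists>x. big x" using big_max unfolding back_cliques_le_def by (meson not_le)
  then obtain p where p: "big p" and least: "\<And>x. big x \<Longrightarrow> pos p \<le> pos x"
    using ex_has_least_nat[of big _ pos] by metis
  have pY: "p \<in> Y" using p by (simp add: big_def)
  have ne: "pos z \<noteq> pos p" if "z \<in> X - Y" for z
    using that pY X by (auto dest: inj_onD)
  have "pos z < pos p" if z: "z \<in> X - Y" "y \<in> Y" "(z, y) \<in> E" for z y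
  proof (rule ccontr)
    assume "\<not> pos z < pos p"
    then have "pos p < pos z" using ne z by fastforce
    then have "back_cliques_le E pos {y \<in> Y. pos y \<le> pos p} w"
      using z hom(1)[of z y] by (intro ext[of _ z]) auto
    then show False using p by (simp add: big_def)
  qed
  moreover have "pos p < pos z" if z: "z \<in> X - Y" "y \<in> Y" "(y, z) \<in> E" for z y
  proof (rule ccontr)
    assume "\<not> pos p < pos z"
    then have less: "pos z < pos p" using ne z by fastforce
    \<comment> \<open>Now \<open>z\<close> cuts \<open>Y\<close> into two halves, each with small back-cliques: the lower half by the
      choice of \<open>p\<close>, the upper half because its vertices are joined to \<open>z\<close> by backedges.\<close>
    have "back_cliques_le E pos {y \<in> Y. pos y < pos z} w"
      unfolding back_cliques_le_def
    proof (intro allI impI, rule ccontr)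
      fix C assume C: "C \<subseteq> {y \<in> Y. pos y < pos z}" "back_clique E pos C" "\<not> card C \<le> w"
      then obtain x where "x \<in> C" "big x" using big_max[of C] by auto
      then show False using least[of x] C less by auto
    qed
    then have l: "dicolorable E {y \<in> Y. pos y < pos z} g" by (intro smaller) auto
    have "back_cliques_le E pos {y \<in> Y. pos z < pos y} w"
      using z hom(2)[of z y] by (intro ext[of _ z]) auto
    then have r: "dicolorable E {y \<in> Y. pos z < pos y} g" by (intro smaller) auto
    have "pos y \<noteq> pos z" if "y \<in> Y" for y using that z X by (auto dest: inj_onD)
    then have "Y \<subseteq> {y \<in> Y. pos y < pos z} \<union> {y \<in> Y. pos z < pos y}"
      by (auto simp: neq_iff)
    then show False using dicolorable_Un[OF l r] not by (simp add: mult_2)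
  qed
  ultimately show ?thesis using pY by blast
qed

text \<open>
  One level of the recursion. The palette of \<open>2 * k * g\<close> colours has two uses: parts that
  need many colours use it freely, while the other parts use it as \<open>k\<close> disjoint palettes of
  size \<open>2 * g\<close>, selected by a colouring of the quotient without monochromatic backedges.
\<close>

lemma dicolorable_parts:
  fixes q :: "'a \<Rightarrow> 'a"
  assumes X: "finite X" "inj_on pos X" and k: "0 < k" and g: "0 < g"
    and w: "back_cliques_le E pos X (Suc w)"
    and hom: "\<And>x y x' y'. x \<in> X \<Longrightarrow> y \<in> X \<Longrightarrow> x' \<in> X \<Longrightarrow> y' \<in> X \<Longrightarrow>
       q x = q x' \<Longrightarrow> q y = q y' \<Longrightarrow> q x \<noteq> q y \<Longrightarrow> (x, y) \<in> E \<Longrightarrow> (x', y') \<in> E"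
    and quotient: "\<And>T. T \<subseteq> X \<Longrightarrow> inj_on q T \<Longrightarrow>
       \<exists>c. c ` T \<subseteq> {..<k} \<and> (\<forall>x\<in>T. \<forall>y\<in>T. (x, y) \<in> E \<longrightarrow> pos y < pos x \<longrightarrow> c x \<noteq> c y)"
    and smaller: "\<And>Z. Z \<subseteq> X \<Longrightarrow> back_cliques_le E pos Z w \<Longrightarrow> dicolorable E Z g"
    and part: "\<And>t. dicolorable E {x \<in> X. q x = t} (2 * k * g)"
  shows "dicolorable E X (2 * k * g)"
proof -
  let ?part = "\<lambda>t. {x \<in> X. q x = t}"
  define cheap where "cheap t \<longleftrightarrow> dicolorable E (?part t) (2 * g)" for t
  have "\<exists>\<rho>. t \<in> q ` X \<longrightarrow> \<rho> \<in> ?part t \<and> (\<not> cheap t \<longrightarrow> (\<forall>z\<in>X - ?part t. \<forall>y\<in>?part t.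
      ((z, y) \<in> E \<longrightarrow> pos z < pos \<rho>) \<and> ((y, z) \<in> E \<longrightarrow> pos \<rho> < pos z)))" for t
  proof (cases "cheap t")
    case True
    then show ?thesis by auto
  next
    case False
    have "\<exists>p\<in>?part t. \<forall>z\<in>X - ?part t. \<forall>y\<in>?part t.
      ((z, y) \<in> E \<longrightarrow> pos z < pos p) \<and> ((y, z) \<in> E \<longrightarrow> pos p < pos z)"
    proof (rule threshold_position[OF X _ w])
      show "(z, y') \<in> E" if "z \<in> X - ?part t" "y \<in> ?part t" "y' \<in> ?part t" "(z, y) \<in> E" for z y y'
        using hom[of z y z y'] that by auto
      show "(y', z) \<in> E" if "z \<in> X - ?part t" "y \<in> ?part t" "y' \<in> ?part t" "(y, z) \<in> E" for z y y'
        using hom[of y z y' z] that by auto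
      show "\<not> dicolorable E (?part t) (2 * g)" using False by (simp add: cheap_def)
      show "dicolorable E Z g" if "Z \<subseteq> ?part t" "back_cliques_le E pos Z w" for Z
        using that by (intro smaller) auto
    qed auto
    then show ?thesis by blast
  qed
  then obtain \<rho> where \<rho>': "\<forall>t. t \<in> q ` X \<longrightarrow> \<rho> t \<in> ?part t \<and> (\<not> cheap t \<longrightarrow> (\<forall>z\<in>X - ?part t. \<forall>y\<in>?part t.
      ((z, y) \<in> E \<longrightarrow> pos z < pos (\<rho> t)) \<and> ((y, z) \<in> E \<longrightarrow> pos (\<rho> t) < pos z)))"
    using choice[of "\<lambda>t \<rho>. t \<in> q ` X \<longrightarrow> \<rho> \<in> ?part t \<and> (\<not> cheap t \<longrightarrow> (\<forall>z\<in>X - ?part t. \<forall>y\<in>?part t.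
      ((z, y) \<in> E \<longrightarrow> pos z < pos \<rho>) \<and> ((y, z) \<in> E \<longrightarrow> pos \<rho> < pos z)))"] by blast
  then have \<rho>: "\<And>t. t \<in> q ` X \<Longrightarrow> \<rho> t \<in> ?part t" by blast
  have exp: "((z, y) \<in> E \<longrightarrow> pos z < pos (\<rho> t)) \<and> ((y, z) \<in> E \<longrightarrow> pos (\<rho> t) < pos z)"
    if "t \<in> q ` X" "\<not> cheap t" "z \<in> X - ?part t" "y \<in> ?part t" for t z y
    using \<rho>'[rule_format, OF that(1)] that(2-4) by blast
  have rep: "\<rho> (q x) \<in> X" "q (\<rho> (q x)) = q x" if "x \<in> X" for x
    using \<rho>[of "q x"] that by auto
  have "\<forall>t. \<exists>c. c ` ?part t \<subseteq> {..<(if cheap t then 2 * g else 2 * k * g)} \<and>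
      acyclic (mono_arcs E (?part t) c)"
    using part unfolding cheap_def dicolorable_def by simp
  then have "\<exists>c. \<forall>t. c t ` ?part t \<subseteq> {..<(if cheap t then 2 * g else 2 * k * g)} \<and>
      acyclic (mono_arcs E (?part t) (c t))"
    by (rule choice)
  then obtain c where c: "\<And>t. c t ` ?part t \<subseteq> {..<(if cheap t then 2 * g else 2 * k * g)}"
    and acyc: "\<And>t. acyclic (mono_arcs E (?part t) (c t))" by blast
  have c_cheap: "c (q x) x < 2 * g" if "x \<in> X" "cheap (q x)" for x
    using c[of "q x"] that by auto
  have c_all: "c (q x) x < 2 * k * g" if "x \<in> X" "\<not> cheap (q x)" for x
    using c[of "q x"] that by auto
  \<comment> \<open>The quotient has to be coloured on the cheap parts only: the other parts are already placed
    correctly by their threshold vertices.\<close>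
  define T where "T = \<rho> ` {t \<in> q ` X. cheap t}"
  have T: "T \<subseteq> X" "inj_on q T" using \<rho> by (auto simp: T_def inj_on_def)
  from quotient[OF T] obtain \<kappa> where \<kappa>': "\<kappa> ` T \<subseteq> {..<k} \<and>
    (\<forall>x\<in>T. \<forall>y\<in>T. (x, y) \<in> E \<longrightarrow> pos y < pos x \<longrightarrow> \<kappa> x \<noteq> \<kappa> y)" by (rule exE)
  have \<kappa>: "\<kappa> ` T \<subseteq> {..<k}"
    "\<And>x y. x \<in> T \<Longrightarrow> y \<in> T \<Longrightarrow> (x, y) \<in> E \<Longrightarrow> pos y < pos x \<Longrightarrow> \<kappa> x \<noteq> \<kappa> y"
    using \<kappa>' by simp_all
  have inT: "\<rho> (q x) \<in> T" if "x \<in> X" "cheap (q x)" for x using that by (auto simp: T_def)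
  define d where "d x = (if cheap (q x) then \<kappa> (\<rho> (q x)) * (2 * g) + c (q x) x else c (q x) x)" for x
  have "d x < 2 * k * g" if x: "x \<in> X" for x
  proof (cases "cheap (q x)")
    case True
    then have "Suc (\<kappa> (\<rho> (q x))) \<le> k" using \<kappa>(1) inT[OF x] by (auto simp: Suc_le_eq)
    then have "Suc (\<kappa> (\<rho> (q x))) * (2 * g) \<le> k * (2 * g)" by (rule mult_le_mono1)
    then show ?thesis using c_cheap[OF x True] True by (simp add: d_def algebra_simps)
  next
    case False
    then show ?thesis using c_all[OF x] by (simp add: d_def)
  qed
  moreover have "acyclic (mono_arcs E X d)"
  proof (rule acyclic_blocks[where q = q and h = "\<lambda>t. pos (\<rho> t)"])
    fix x y assume "(x, y) \<in> mono_arcs E X d" and ne: "q x \<noteq> q y"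
    then have xy: "x \<in> X" "y \<in> X" "(x, y) \<in> E" "d x = d y" by (auto simp: mono_arcs_def)
    have reps: "(\<rho> (q x), \<rho> (q y)) \<in> E"
      using hom[of x y "\<rho> (q x)" "\<rho> (q y)"] xy ne rep by auto
    show "pos (\<rho> (q x)) < pos (\<rho> (q y))"
    proof (cases "cheap (q x)")
      case False
      then show ?thesis using exp[of "q x" "\<rho> (q y)" "\<rho> (q x)"] reps xy rep ne by auto
    next
      case cheap_x: True
      show ?thesis
      proof (cases "cheap (q y)")
        case False
        then show ?thesis using exp[of "q y" "\<rho> (q x)" "\<rho> (q y)"] reps xy rep ne by auto
      next
        case cheap_y: True
        have "d z div (2 * g) = \<kappa> (\<rho> (q z))" if "z \<in> X" "cheap (q z)" for z
          using c_cheap[OF that] that(2) g by (simp add: d_def)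
        then have "\<kappa> (\<rho> (q x)) = \<kappa> (\<rho> (q y))"
          using xy cheap_x cheap_y by metis
        then have "\<not> pos (\<rho> (q y)) < pos (\<rho> (q x))"
          using \<kappa>(2)[OF _ _ reps] inT xy cheap_x cheap_y by blast
        moreover have "pos (\<rho> (q x)) \<noteq> pos (\<rho> (q y))"
          using X(2) rep xy ne by (metis inj_onD)
        ultimately show ?thesis by simp
      qed
    qed
  next
    fix t
    show "acyclic {(x, y) \<in> mono_arcs E X d. q x = t \<and> q y = t}"
      by (rule acyclic_subset[OF acyc[of t]]) (auto simp: mono_arcs_def d_def split: if_splits)
  qed
  ultimately show ?thesis unfolding dicolorable_def by blast
qed

text \<open>
  The outer induction is on the size \<open>w\<close> of the back-cliques, the inner one on the decomposition.
  The bound \<open>W\<close> stays fixed, so that one value of \<open>k\<close> serves all levels of the outer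
  induction.
\<close>

lemma decomposable_imp_dicolorable:
  assumes quotient: "\<And>T. restr E T \<in> \<D> \<Longrightarrow> finite T \<Longrightarrow> inj_on pos T \<Longrightarrow> back_cliques_le E pos T W \<Longrightarrow>
       \<exists>c. c ` T \<subseteq> {..<k} \<and> (\<forall>x\<in>T. \<forall>y\<in>T. (x, y) \<in> E \<longrightarrow> pos y < pos x \<longrightarrow> c x \<noteq> c y)"
  shows "decomposable \<D> E X \<Longrightarrow> finite X \<Longrightarrow> inj_on pos X \<Longrightarrow> w \<le> W \<Longrightarrow>
    back_cliques_le E pos X w \<Longrightarrow> dicolorable E X ((2 * k) ^ w)"
proof (induction w arbitrary: X)
  case 0
  have "x \<notin> X" for x
  proof
    assume "x \<in> X"
    then have "card {x} \<le> 0"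
      using 0(5) unfolding back_cliques_le_def back_clique_def by blast
    then show False by simp
  qed
  then have "X = {}" by blast
  then show ?case by (simp add: dicolorable_empty)
next
  case (Suc w)
  \<comment> \<open>Single vertices are members of the class and need a colour.\<close>
  have k: "0 < k" if "decomposable \<D> E X" "x \<in> X" for X x
  proof -
    have "card C \<le> W" if "C \<subseteq> {x}" for C
      using card_mono[OF _ that] Suc.prems(4) by simp
    then have "back_cliques_le E pos {x} W" unfolding back_cliques_le_def by blast
    then show ?thesis using quotient[of "{x}"] decomposable_vertex[OF that] by auto
  qed
  from Suc.prems show ?case
  proof (induction rule: decomposable.induct)
    case empty
    then show ?case by (simp add: dicolorable_empty)
  next
    case (singleton x)
    then show ?case using k[OF decomposable.singleton] by (intro dicolorable_singleton) auto
  next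
    case (parts X q)
    have dX: "decomposable \<D> E X" by (rule decomposable.parts[of X q]) (use parts.hyps in blast)+
    show ?case
    proof (cases "X = {}")
      case True
      then show ?thesis by (simp add: dicolorable_empty)
    next
      case False
      then have k0: "0 < k" using k[OF dX] by auto
      have "dicolorable E X (2 * k * (2 * k) ^ w)"
      proof (rule dicolorable_parts[where q = q and pos = pos and w = w])
        show "dicolorable E {x \<in> X. q x = t} (2 * k * (2 * k) ^ w)" for t
          using parts.IH[of t] parts.prems
            back_cliques_le_mono[OF parts.prems(4), of "{x \<in> X. q x = t}" "Suc w"]
          by (auto intro: inj_on_subset)
        show "dicolorable E Z ((2 * k) ^ w)" if "Z \<subseteq> X" "back_cliques_le E pos Z w" for Z
          using that parts.prems
          by (intro Suc.IH decomposable_subset[OF dX]) (auto intro: finite_subset inj_on_subset)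
        show "\<exists>c. c ` T \<subseteq> {..<k} \<and> (\<forall>x\<in>T. \<forall>y\<in>T. (x, y) \<in> E \<longrightarrow> pos y < pos x \<longrightarrow> c x \<noteq> c y)"
          if "T \<subseteq> X" "inj_on q T" for T
          using that parts.prems parts.hyps(1)[OF that]
          by (intro quotient) (auto intro: finite_subset inj_on_subset back_cliques_le_mono)
        show "(x', y') \<in> E"
          if "x \<in> X" "y \<in> X" "x' \<in> X" "y' \<in> X" "q x = q x'" "q y = q y'" "q x \<noteq> q y" "(x, y) \<in> E"
          for x y x' y'
          using parts.hyps(2)[of x y x' y'] that by blast
      qed (use parts.prems k0 in auto)
      then show ?thesis by simp
    qed
  qed
qed

section \<open>Classes closed under substitution\<close>

lemma finite_subst_closure:
  assumes "\<And>D. D \<in> \<D> \<Longrightarrow> finite (pverts D)"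
  shows "D \<in> subst_closure \<D> \<Longrightarrow> finite (pverts D)"
  by (induction rule: subst_closure.induct) (auto simp: substitute_def assms)

lemma subst_closure_arcs:
  assumes "\<And>D. D \<in> \<D> \<Longrightarrow> parcs D \<subseteq> {(x, y) \<in> pverts D \<times> pverts D. x \<noteq> y}"
  shows "D \<in> subst_closure \<D> \<Longrightarrow> parcs D \<subseteq> {(x, y) \<in> pverts D \<times> pverts D. x \<noteq> y}"
proof (induction rule: subst_closure.induct)
  case (base D)
  then show ?case by (rule assms)
next
  case (subst D1 D2 u)
  have D1: "x \<in> pverts D1 \<and> y \<in> pverts D1 \<and> x \<noteq> y" if "(x, y) \<in> parcs D1" for x y
    using subst.IH(1) that by blast
  have D2: "x \<in> pverts D2 \<and> y \<in> pverts D2 \<and> x \<noteq> y" if "(x, y) \<in> parcs D2" for x y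
    using subst.IH(2) that by blast
  have disj: "x \<notin> pverts D2" if "x \<in> pverts D1" for x using subst.hyps(3) that by blast
  have "x \<in> pverts (substitute D1 u D2) \<and> y \<in> pverts (substitute D1 u D2) \<and> x \<noteq> y"
    if "(x, y) \<in> parcs (substitute D1 u D2)" for x y
  proof -
    consider "(x, y) \<in> parcs D1" "x \<noteq> u" "y \<noteq> u" | "(x, y) \<in> parcs D2"
      | "(x, u) \<in> parcs D1" "y \<in> pverts D2" | "(u, y) \<in> parcs D1" "x \<in> pverts D2"
      using \<open>(x, y) \<in> parcs (substitute D1 u D2)\<close> by (auto simp: substitute_def)
    then show ?thesis
    proof cases
      case 1
      then show ?thesis using D1[of x y]
        by (simp add: substitute_def)
    next
      case 2
      then show ?thesis using D2[of x y]
        by (simp add: substitute_def)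
    next
      case 3
      then show ?thesis using D1[of x u] disj[of x] by (auto simp: substitute_def)
    next
      case 4
      then show ?thesis using D1[of u y] disj[of y] by (auto simp: substitute_def)
    qed
  qed
  then show ?case by auto
qed

lemma digraph_class_restr:
  assumes "digraph_class \<D>" "D \<in> \<D>" "T \<subseteq> pverts D"
  shows "restr (parcs D) T \<in> \<D>"
proof -
  interpret oriented_digraph D using assms unfolding digraph_class_def by blast
  have "induced_subgraph (with_proj (restr (parcs D) T)) (with_proj D)"
    unfolding induced_subgraph_def subgraph_def compatible_def
    using assms(3) by (auto simp: restr_def wf_digraph_axioms wf_digraph_def)
  then show ?thesis using assms unfolding digraph_class_def by blast
qed

text \<open>
  A member of the class is decomposed into its single vertices by the identity labelling. A
  substitution is a blow-up of the outer digraph in which only the fibre over \<open>u\<close> is not a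
  single vertex.
\<close>

lemma subst_closure_decomposable:
  assumes cls: "digraph_class \<D>"
  shows "D \<in> subst_closure \<D> \<Longrightarrow> decomposable \<D> (parcs D) (pverts D)"
proof (induction rule: subst_closure.induct)
  case (base D)
  interpret oriented_digraph D using base cls unfolding digraph_class_def by blast
  show ?case
  proof (rule decomposable.parts[where q = "\<lambda>x. x"])
    fix t
    show "decomposable \<D> (parcs D) {x \<in> pverts D. x = t}"
    proof (cases "t \<in> pverts D")
      case True
      then have "{x \<in> pverts D. x = t} = {t}" by auto
      then show ?thesis
        using digraph_class_restr[OF cls base, of "{t}"] True no_loops'[of t t]
        by (auto intro: decomposable.singleton)
    next
      case False
      then have "{x \<in> pverts D. x = t} = {}" by auto
      then show ?thesis using decomposable.empty by metis
    qed
  qed (use digraph_class_restr[OF cls base] in auto)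
next
  case (subst D1 D2 u)
  have oriented: "oriented_digraph D" if "D \<in> \<D>" for D
    using cls that unfolding digraph_class_def by blast
  have arcs: "parcs D \<subseteq> {(x, y) \<in> pverts D \<times> pverts D. x \<noteq> y}" if "D \<in> subst_closure \<D>" for D
  proof (rule subst_closure_arcs[OF _ that])
    fix D assume "D \<in> \<D>"
    then interpret oriented_digraph D by (rule oriented)
    show "parcs D \<subseteq> {(x, y) \<in> pverts D \<times> pverts D. x \<noteq> y}"
      using in_arcsD1 in_arcsD2 no_loops' by blast
  qed
  let ?E = "parcs (substitute D1 u D2)" and ?V = "pverts (substitute D1 u D2)"
  have V: "?V = (pverts D1 - {u}) \<union> pverts D2" by (simp add: substitute_def)
  have E: "(x, y) \<in> ?E \<longleftrightarrow> ((x, y) \<in> parcs D1 \<and> x \<noteq> u \<and> y \<noteq> u) \<or> (x, y) \<in> parcs D2 \<or>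
      (x, u) \<in> parcs D1 \<and> y \<in> pverts D2 \<or> (u, y) \<in> parcs D1 \<and> x \<in> pverts D2" for x y
    by (auto simp: substitute_def)
  have D1: "x \<in> pverts D1 \<and> y \<in> pverts D1" if "(x, y) \<in> parcs D1" for x y
    using arcs[OF subst.hyps(1)] that by blast
  have D2: "x \<in> pverts D2 \<and> y \<in> pverts D2" if "(x, y) \<in> parcs D2" for x y
    using arcs[OF subst.hyps(2)] that by blast
  have disj: "x \<notin> pverts D2" if "x \<in> pverts D1" for x using subst.hyps(3) that by blast
  define \<sigma> where "\<sigma> x = (if x \<in> pverts D2 then u else x)" for x
  show ?case
  proof (rule decomposable_blow_up[where \<sigma> = \<sigma>, OF _ subst.IH(1)])
    show "H \<in> \<D>" if "D \<in> \<D>" "digraph_iso (with_proj D) (with_proj H)" for D H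
      using cls that unfolding digraph_class_def by blast
    show "\<sigma> ` ?V \<subseteq> pverts D1" using subst.hyps by (auto simp: V \<sigma>_def)
    show "(x, y) \<in> ?E \<longleftrightarrow> (\<sigma> x, \<sigma> y) \<in> parcs D1"
      if xy: "x \<in> ?V" "y \<in> ?V" "\<sigma> x \<noteq> \<sigma> y" for x y
    proof -
      consider (left) "x \<in> pverts D2" "y \<in> pverts D1" "y \<noteq> u" "y \<notin> pverts D2"
        | (right) "y \<in> pverts D2" "x \<in> pverts D1" "x \<noteq> u" "x \<notin> pverts D2"
        | (outside) "x \<in> pverts D1" "x \<noteq> u" "x \<notin> pverts D2" "y \<in> pverts D1" "y \<noteq> u" "y \<notin> pverts D2"
        using xy by (auto simp: V \<sigma>_def split: if_splits)
      then show ?thesis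
      proof cases
        case left
        then have "x \<notin> pverts D1" using disj by blast
        then show ?thesis using left D1[of x y] D1[of x u] D2[of x y] unfolding E \<sigma>_def by auto
      next
        case right
        then have "y \<notin> pverts D1" using disj by blast
        then show ?thesis using right D1[of x y] D1[of u y] D2[of x y] unfolding E \<sigma>_def by auto
      next
        case outside
        then show ?thesis using D2[of x y] unfolding E \<sigma>_def by auto
      qed
    qed
    show "decomposable \<D> ?E {y \<in> ?V. \<sigma> y = v}" if v: "v \<in> pverts D1" for v
    proof (cases "v = u")
      case True
      have fibre: "{y \<in> ?V. \<sigma> y = v} = pverts D2" using True by (auto simp: V \<sigma>_def)
      have "(x, y) \<in> parcs D2 \<longleftrightarrow> (x, y) \<in> ?E" if "x \<in> pverts D2" "y \<in> pverts D2" for x y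
      proof -
        have "x \<notin> pverts D1" "y \<notin> pverts D1" using that subst.hyps(3) by auto
        then show ?thesis using D1[of x u] D1[of u y] D1[of x y] unfolding E by blast
      qed
      then have "parcs D2 \<inter> pverts D2 \<times> pverts D2 = ?E \<inter> pverts D2 \<times> pverts D2" by auto
      then show ?thesis using decomposable_cong[OF subst.IH(2)] fibre by simp
    next
      case False
      then have v2: "v \<notin> pverts D2" using v subst.hyps(3) by auto
      then have fibre: "{y \<in> ?V. \<sigma> y = v} = {v}" using False v by (auto simp: V \<sigma>_def)
      have "(v, v) \<in> parcs D1 \<longleftrightarrow> (v, v) \<in> ?E" using False v2 D2[of v v] unfolding E by blast
      then have "parcs D1 \<inter> {v} \<times> {v} = ?E \<inter> {v} \<times> {v}" by auto
      moreover have "decomposable \<D> (parcs D1) {v}"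
        using decomposable_subset[OF subst.IH(1)] v by auto
      ultimately show ?thesis using decomposable_cong fibre by metis
    qed
  qed
qed

section \<open>Dichromatic number and clique number in terms of arc sets\<close>

lemma acyclic_digraph_iff: "acyclic_digraph (with_proj D \<restriction> S) \<longleftrightarrow> acyclic (parcs D \<inter> S \<times> S)"
proof -
  let ?G = "with_proj D \<restriction> S"
  interpret wf_digraph ?G by unfold_locales auto
  have ends: "arcs_ends ?G = parcs D \<inter> S \<times> S"
    by (auto simp: arcs_ends_def arc_to_ends_def)
  have "(\<exists>p. cycle p) \<longleftrightarrow> (\<exists>p. closed_w p)"
  proof
    assume "\<exists>p. cycle p"
    then show "\<exists>p. closed_w p" unfolding cycle_altdef by blast
  next
    assume "\<exists>p. closed_w p"
    then show "\<exists>p. cycle p" by (elim exE) (rule closed_w_imp_cycle)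
  qed
  also have "\<dots> \<longleftrightarrow> (\<exists>u. (u, u) \<in> (arcs_ends ?G)\<^sup>+)"
    unfolding closed_w_def reachable1_awalk length_greater_0_conv by (rule ex_comm)
  finally show ?thesis by (auto simp: acyclic_digraph_def acyclic_def ends)
qed

lemma dichromatic_number_le:
  assumes "dicolorable (parcs D) (pverts D) n"
  shows "dichromatic_number D \<le> n"
proof -
  obtain c where c: "c ` pverts D \<subseteq> {..<n}" "acyclic (mono_arcs (parcs D) (pverts D) c)"
    using assms unfolding dicolorable_def by blast
  define P where "P = (\<lambda>i. {x \<in> pverts D. c x = i}) ` (c ` pverts D)"
  have "partition_on (pverts D) P"
    by (rule partition_onI) (auto simp: P_def disjnt_def)
  moreover have "acyclic_digraph (with_proj D \<restriction> S)" if S: "S \<in> P" for S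
    unfolding acyclic_digraph_iff
    by (rule acyclic_subset[OF c(2)]) (use S in \<open>auto simp: P_def mono_arcs_def\<close>)
  ultimately have "dichromatic_number D \<le> card P"
    unfolding dichromatic_number_def by (intro Least_le) blast
  also have "card P \<le> card (c ` pverts D)"
    unfolding P_def using c(1) by (intro card_image_le) (auto intro: finite_subset)
  also have "\<dots> \<le> card {..<n}" using c(1) by (intro card_mono) auto
  finally show ?thesis by simp
qed

lemma (in oriented_digraph) dicolorable_dichromatic_number:
  "dicolorable (parcs G) (pverts G) (dichromatic_number G)"
proof -
  let ?good = "\<lambda>P. partition_on (pverts G) P \<and> (\<forall>S\<in>P. acyclic_digraph (with_proj G \<restriction> S))"
  have "\<exists>P. ?good P"
  proof (intro exI conjI ballI)
    show "partition_on (pverts G) ((\<lambda>x. {x}) ` pverts G)"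
      by (rule partition_onI) (auto simp: disjnt_def)
    fix S assume "S \<in> (\<lambda>x. {x}) ` pverts G"
    then have "parcs G \<inter> S \<times> S = {}" using no_loops' by auto
    then show "acyclic_digraph (with_proj G \<restriction> S)" by (simp add: acyclic_digraph_iff acyclic_def)
  qed
  then have "\<exists>k P. partition_on (pverts G) P \<and> card P = k \<and>
      (\<forall>S\<in>P. acyclic_digraph (with_proj G \<restriction> S))" by blast
  from LeastI_ex[OF this, folded dichromatic_number_def]
  obtain P where P': "partition_on (pverts G) P \<and> card P = dichromatic_number G \<and>
    (\<forall>S\<in>P. acyclic_digraph (with_proj G \<restriction> S))" by (rule exE)
  then have P: "partition_on (pverts G) P" "card P = dichromatic_number G" by simp_all
  have P_acyclic: "acyclic_digraph (with_proj G \<restriction> S)" if "S \<in> P" for S using P' that by blast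
  have "finite P" using P(1) pair_finite_verts by (metis finite_elements)
  then obtain num where num: "bij_betw num P {0..<card P}" using ex_bij_betw_finite_nat by blast
  have "\<forall>x\<in>pverts G. \<exists>S. S \<in> P \<and> x \<in> S"
    using partition_onD1[OF P(1)] by blast
  then obtain S where "\<forall>x\<in>pverts G. S x \<in> P \<and> x \<in> S x" by (elim bchoice[THEN exE])
  then have S: "\<And>x. x \<in> pverts G \<Longrightarrow> S x \<in> P \<and> x \<in> S x" by blast
  have "(\<lambda>x. num (S x)) ` pverts G \<subseteq> {..<dichromatic_number G}"
    using S num P(2) unfolding bij_betw_def by auto
  moreover have "acyclic (mono_arcs (parcs G) (pverts G) (\<lambda>x. num (S x)))"
  proof (rule acyclic_blocks[where q = S and h = "\<lambda>_. 0"])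
    fix x y assume "(x, y) \<in> mono_arcs (parcs G) (pverts G) (\<lambda>x. num (S x))" "S x \<noteq> S y"
    then have "S x \<in> P" "S y \<in> P" "num (S x) = num (S y)" using S by (auto simp: mono_arcs_def)
    then have "S x = S y" using num by (auto simp: bij_betw_def dest: inj_onD)
    then show "(0::nat) < 0" using \<open>S x \<noteq> S y\<close> by simp
  next
    fix t
    show "acyclic {(x, y) \<in> mono_arcs (parcs G) (pverts G) (\<lambda>x. num (S x)). S x = t \<and> S y = t}"
    proof (cases "t \<in> P")
      case True
      then show ?thesis using S
        by (intro acyclic_subset[OF P_acyclic[OF True, unfolded acyclic_digraph_iff]])
          (auto simp: mono_arcs_def)
    next
      case False
      then have "{(x, y) \<in> mono_arcs (parcs G) (pverts G) (\<lambda>x. num (S x)). S x = t \<and> S y = t} = {}"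
        using S by (auto simp: mono_arcs_def)
      then show ?thesis by (simp only:) (simp add: acyclic_def)
    qed
  qed
  ultimately show ?thesis unfolding dicolorable_def by blast
qed

lemma finite_linear_orders: "finite V \<Longrightarrow> finite {r. linear_order_on V r}"
  by (rule finite_subset[of _ "Pow (V \<times> V)"])
    (auto simp: linear_order_on_def partial_order_on_def preorder_on_def refl_on_def)

lemma linear_order_of_positions:
  assumes "inj_on pos V"
  shows "linear_order_on V {(x, y) \<in> V \<times> V. pos x \<le> (pos y :: nat)}"
proof -
  let ?r = "{(x, y) \<in> V \<times> V. pos x \<le> pos y}"
  have "refl_on V ?r" "trans ?r" "total_on V ?r" "?r \<subseteq> V \<times> V"
    by (auto simp: refl_on_def trans_def total_on_def)
  moreover have "antisym ?r"
    using assms by (auto intro!: antisymI dest: inj_onD)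
  ultimately show ?thesis
    unfolding linear_order_on_def partial_order_on_def preorder_on_def by blast
qed

lemma positions_of_linear_order:
  assumes fin: "finite V" and r: "linear_order_on V r"
  obtains pos :: "'a \<Rightarrow> nat" where "inj_on pos V"
    "\<And>x y. x \<in> V \<Longrightarrow> y \<in> V \<Longrightarrow> pos x < pos y \<Longrightarrow> (x, y) \<in> r"
proof -
  have tr: "trans r" and as: "antisym r" and tot: "total_on V r" and rf: "refl_on V r"
    and sub: "r \<subseteq> V \<times> V"
    using r unfolding linear_order_on_def partial_order_on_def preorder_on_def by auto
  define pos where "pos x = card {y \<in> V. (y, x) \<in> r}" for x
  have less: "pos x < pos y" if "x \<in> V" "y \<in> V" "(x, y) \<in> r" "x \<noteq> y" for x y
    unfolding pos_def
  proof (rule psubset_card_mono)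
    show "finite {z \<in> V. (z, y) \<in> r}" using fin by simp
    have "{z \<in> V. (z, x) \<in> r} \<subseteq> {z \<in> V. (z, y) \<in> r}" using that(3) tr by (auto dest: transD)
    moreover have "y \<notin> {z \<in> V. (z, x) \<in> r}" using that as by (auto dest: antisymD)
    moreover have "y \<in> {z \<in> V. (z, y) \<in> r}" using that rf by (auto dest: refl_onD)
    ultimately show "{z \<in> V. (z, x) \<in> r} \<subset> {z \<in> V. (z, y) \<in> r}" by blast
  qed
  show thesis
  proof
    show "inj_on pos V"
    proof (rule inj_onI, rule ccontr)
      fix x y assume xy: "x \<in> V" "y \<in> V" "pos x = pos y" "x \<noteq> y"
      then have "(x, y) \<in> r \<or> (y, x) \<in> r" using tot by (auto simp: total_on_def)
      then show False using less[of x y] less[of y x] xy by auto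
    qed
    fix x y assume xy: "x \<in> V" "y \<in> V" "pos x < pos y"
    then have "(x, y) \<in> r \<or> (y, x) \<in> r" using tot by (auto simp: total_on_def)
    then show "(x, y) \<in> r" using less[of y x] xy by (cases "x = y") auto
  qed
qed

lemma card_clique_le_clique_number:
  assumes "finite V" "S \<subseteq> V" "clique S E"
  shows "card S \<le> clique_number V E"
  unfolding clique_number_def using assms by (intro Max_ge) auto

lemma clique_number_attained:
  assumes "finite V"
  obtains S where "S \<subseteq> V" "clique S E" "card S = clique_number V E"
proof -
  have "clique_number V E \<in> card ` {S. S \<subseteq> V \<and> clique S E}"
    unfolding clique_number_def
  proof (rule Max_in)
    show "finite (card ` {S. S \<subseteq> V \<and> clique S E})" using assms by simp
    have "{} \<in> {S. S \<subseteq> V \<and> clique S E}" by simp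
    then show "card ` {S. S \<subseteq> V \<and> clique S E} \<noteq> {}" by blast
  qed
  then obtain S where "S \<in> {S. S \<subseteq> V \<and> clique S E}" "clique_number V E = card S" by (rule imageE)
  then show thesis using that[of S] by simp
qed

lemma digraph_clique_number_attained:
  assumes fin: "finite (pverts D)"
  obtains pos :: "'a \<Rightarrow> nat" where "inj_on pos (pverts D)"
    "back_cliques_le (parcs D) pos (pverts D) (digraph_clique_number D)"
proof -
  have "\<exists>r. linear_order_on (pverts D) r"
  proof -
    obtain pos :: "'a \<Rightarrow> nat" where "inj_on pos (pverts D)"
      using finite_imp_inj_to_nat_seg[OF fin] by blast
    then show ?thesis using linear_order_of_positions by blast
  qed
  then have "digraph_clique_number D \<in>
      (\<lambda>r. clique_number (pverts D) (backedges D r)) ` {r. linear_order_on (pverts D) r}"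
    unfolding digraph_clique_number_def
    using finite_linear_orders[OF fin] by (intro Min_in) auto
  then obtain r where r: "linear_order_on (pverts D) r"
    "digraph_clique_number D = clique_number (pverts D) (backedges D r)" by blast
  obtain pos :: "'a \<Rightarrow> nat" where pos: "inj_on pos (pverts D)"
    "\<And>x y. x \<in> pverts D \<Longrightarrow> y \<in> pverts D \<Longrightarrow> pos x < pos y \<Longrightarrow> (x, y) \<in> r"
    using positions_of_linear_order[OF fin r(1)] by blast
  have "card C \<le> digraph_clique_number D"
    if C: "C \<subseteq> pverts D" "back_clique (parcs D) pos C" for C
    unfolding r(2)
  proof (rule card_clique_le_clique_number[OF fin C(1)])
    have edge: "{x, y} \<in> backedges D r" if "x \<in> C" "y \<in> C" "pos x < pos y" for x y
    proof -
      have "(y, x) \<in> parcs D" using C(2) that unfolding back_clique_def by blast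
      moreover have "(x, y) \<in> r" using pos(2) C(1) that by blast
      moreover have "x \<noteq> y" using that by auto
      ultimately show ?thesis unfolding backedges_def by blast
    qed
    show "clique C (backedges D r)"
      unfolding clique_def
    proof (intro ballI impI)
      fix x y assume xy: "x \<in> C" "y \<in> C" "x \<noteq> y"
      then have "pos x \<noteq> pos y" using pos(1) C(1) by (auto dest: inj_onD)
      then consider "pos x < pos y" | "pos y < pos x" by linarith
      then show "{x, y} \<in> backedges D r"
        using edge[of x y] edge[of y x] xy by cases (simp_all add: insert_commute)
    qed
  qed
  then show thesis using that[OF pos(1)] unfolding back_cliques_le_def by blast
qed

lemma digraph_clique_number_le:
  assumes fin: "finite (pverts D)" and pos: "inj_on pos (pverts D)"
    and le: "back_cliques_le (parcs D) pos (pverts D) w"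
  shows "digraph_clique_number D \<le> w"
proof -
  let ?r = "{(x, y) \<in> pverts D \<times> pverts D. pos x \<le> pos y}"
  have "digraph_clique_number D \<le> clique_number (pverts D) (backedges D ?r)"
    unfolding digraph_clique_number_def
    using finite_linear_orders[OF fin] linear_order_of_positions[OF pos] by (intro Min_le) auto
  also have "\<dots> \<le> w"
  proof -
    obtain S where S: "S \<subseteq> pverts D" "clique S (backedges D ?r)"
      "card S = clique_number (pverts D) (backedges D ?r)"
      using clique_number_attained[OF fin] by blast
    have "back_clique (parcs D) pos S"
      unfolding back_clique_def
    proof (intro ballI impI)
      fix x y assume xy: "x \<in> S" "y \<in> S" "pos x < pos y"
      then have "x \<noteq> y" by blast
      then have "{x, y} \<in> backedges D ?r" using S(2) xy unfolding clique_def by blast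
      then show "(y, x) \<in> parcs D" using xy(3) by (auto simp: backedges_def doubleton_eq_iff)
    qed
    then show ?thesis using le S(1) unfolding back_cliques_le_def S(3)[symmetric] by blast
  qed
  finally show ?thesis .
qed

lemma digraph_clique_number_pos:
  assumes "finite (pverts D)" "pverts D \<noteq> {}"
  shows "1 \<le> digraph_clique_number D"
proof -
  obtain x where x: "x \<in> pverts D" using assms by blast
  obtain pos :: "'a \<Rightarrow> nat" where "back_cliques_le (parcs D) pos (pverts D) (digraph_clique_number D)"
    using digraph_clique_number_attained[OF assms(1)] by blast
  moreover have "back_clique (parcs D) pos {x}" by (simp add: back_clique_def)
  ultimately have "card {x} \<le> digraph_clique_number D"
    using x unfolding back_cliques_le_def by blast
  then show ?thesis by simp
qed

section \<open>Colourings without monochromatic backedges\<close>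

text \<open>
  The chromatic number is defined as a least number and gives a colouring only once some proper
  colouring is known to exist; an injective one is proper because there are no loops.
\<close>

lemma (in oriented_digraph) chromatic_number_coloring:
  assumes "chromatic_number (pverts G) (underlying_edges G) \<le> K"
  shows "\<exists>c. c ` pverts G \<subseteq> {..<K} \<and> (\<forall>x\<in>pverts G. \<forall>y\<in>pverts G. (x, y) \<in> parcs G \<longrightarrow> c x \<noteq> c y)"
proof -
  let ?proper = "\<lambda>c :: 'a \<Rightarrow> nat. \<forall>u\<in>pverts G. \<forall>v\<in>pverts G. {u, v} \<in> underlying_edges G \<longrightarrow> c u \<noteq> c v"
  obtain f :: "'a \<Rightarrow> nat" and n where f: "f ` pverts G = {i. i < n}" "inj_on f (pverts G)"
    using finite_imp_inj_to_nat_seg[OF pair_finite_verts] by blast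
  have "u \<noteq> v" if "{u, v} \<in> underlying_edges G" for u v
    using that no_loops' by (auto simp: underlying_edges_def doubleton_eq_iff)
  then have "?proper f" using f(2) by (auto dest: inj_onD)
  then have "\<exists>k c. c ` pverts G \<subseteq> {..<k} \<and> ?proper c" using f(1) by blast
  from LeastI_ex[OF this, folded chromatic_number_def]
  obtain c where "c ` pverts G \<subseteq> {..<chromatic_number (pverts G) (underlying_edges G)}" "?proper c"
    by blast
  moreover have "{x, y} \<in> underlying_edges G" if "(x, y) \<in> parcs G" for x y
    using that by (auto simp: underlying_edges_def)
  ultimately show ?thesis using assms by (intro exI[of _ c]) force
qed

text \<open>
  Arcs within a colour class of a dicolouring form a transitive relation, because in a tournament an
  acyclic set has an arc between the ends of every path of length two, and only one direction is
  possible. Hence a back-clique ending at \<open>y\<close> can be extended by every later vertex \<open>x\<close> of the same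
  class with an arc to \<open>y\<close>, and the size \<open>b\<close> of the largest back-clique ending at a vertex
  strictly increases along backedges.
\<close>

lemma (in tournament) acyclic_coloring_refinement:
  assumes pos: "inj_on pos (pverts G)"
    and w: "back_cliques_le (parcs G) pos (pverts G) w"
    and dic: "dicolorable (parcs G) (pverts G) n"
  shows "\<exists>c. c ` pverts G \<subseteq> {..<w * n} \<and>
    (\<forall>x\<in>pverts G. \<forall>y\<in>pverts G. (x, y) \<in> parcs G \<longrightarrow> pos y < pos x \<longrightarrow> c x \<noteq> c y)"
proof -
  obtain a where a: "a ` pverts G \<subseteq> {..<n}" "acyclic (mono_arcs (parcs G) (pverts G) a)"
    using dic unfolding dicolorable_def by blast
  let ?M = "mono_arcs (parcs G) (pverts G) a"
  have trans: "(x, z) \<in> ?M" if "(x, y) \<in> ?M" "(y, z) \<in> ?M" for x y z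
  proof -
    have "(x, z) \<in> ?M\<^sup>+" using that by (rule trancl_into_trancl[OF r_into_trancl])
    then have "x \<noteq> z" "(z, x) \<notin> ?M"
      using a(2) unfolding acyclic_def by (blast, metis trancl_into_trancl)
    then show ?thesis using that adjacent[of x z] by (auto simp: mono_arcs_def)
  qed
  define Q where "Q x = {C. C \<subseteq> {y \<in> pverts G. a y = a x} \<and> back_clique (parcs G) pos C \<and>
    x \<in> C \<and> (\<forall>y\<in>C. pos y \<le> pos x)}" for x
  define b where "b x = Max (card ` Q x)" for x
  have finQ: "finite (Q x)" for x
    by (rule finite_subset[of _ "Pow (pverts G)"]) (auto simp: Q_def pair_finite_verts)
  have neQ: "{x} \<in> Q x" if "x \<in> pverts G" for x using that by (simp add: Q_def back_clique_def)
  have fin_mem: "finite C" if "C \<in> Q x" for C x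
    using that pair_finite_verts finite_subset[of C "pverts G"] by (auto simp: Q_def)
  have b_in: "\<exists>C\<in>Q x. card C = b x" if "x \<in> pverts G" for x
  proof -
    have "b x \<in> card ` Q x"
      unfolding b_def using finQ neQ[OF that] by (intro Max_in) auto
    then show ?thesis by force
  qed
  have b_ge: "card C \<le> b x" if "C \<in> Q x" for C x
    unfolding b_def using finQ that by (intro Max_ge) auto
  have b_bounds: "1 \<le> b x \<and> b x \<le> w" if x: "x \<in> pverts G" for x
  proof
    show "1 \<le> b x" using b_ge[OF neQ[OF x]] by simp
    obtain C where C: "C \<in> Q x" "card C = b x" using b_in[OF x] by blast
    then have "C \<subseteq> pverts G" "back_clique (parcs G) pos C" by (auto simp: Q_def)
    then show "b x \<le> w" using w C(2) unfolding back_cliques_le_def by metis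
  qed
  have b_less: "b y < b x" if "(x, y) \<in> ?M" "pos y < pos x" for x y
  proof -
    have xy: "x \<in> pverts G" "y \<in> pverts G" "a x = a y" using that by (auto simp: mono_arcs_def)
    obtain C where C: "C \<in> Q y" "card C = b y" using b_in[OF xy(2)] by blast
    have arc: "(x, z) \<in> parcs G" if "z \<in> C" for z
    proof (cases "z = y")
      case True
      then show ?thesis using \<open>(x, y) \<in> ?M\<close> by (simp add: mono_arcs_def)
    next
      case False
      then have "pos z \<noteq> pos y" using pos that C(1) xy by (auto simp: Q_def dest: inj_onD)
      then have "pos z < pos y" using C(1) that by (auto simp: Q_def le_less)
      then have "(y, z) \<in> ?M" using C(1) that xy by (auto simp: Q_def back_clique_def mono_arcs_def)
      then have "(x, z) \<in> ?M" using trans[OF \<open>(x, y) \<in> ?M\<close>] by blast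
      then show ?thesis by (simp add: mono_arcs_def)
    qed
    have low: "pos z < pos x" if "z \<in> C" for z
    proof -
      have "pos z \<le> pos y" using C(1) that by (simp add: Q_def)
      then show ?thesis using \<open>pos y < pos x\<close> by simp
    qed
    have "back_clique (parcs G) pos (insert x C)"
      using C(1) arc low unfolding Q_def back_clique_def by (auto dest: less_asym)
    moreover have "insert x C \<subseteq> {z \<in> pverts G. a z = a x}" using C(1) xy by (auto simp: Q_def)
    ultimately have "insert x C \<in> Q x" using low unfolding Q_def by (auto intro: less_imp_le)
    then have "card (insert x C) \<le> b x" by (rule b_ge)
    moreover have "x \<notin> C" using low by blast
    ultimately show ?thesis using C(2) fin_mem[OF C(1)] by simp
  qed
  \<comment> \<open>The pair of \<open>a x\<close> and \<open>b x\<close>, coded in base \<open>w\<close>; the shift makes the second digit less than \<open>w\<close>.\<close>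
  define c where "c x = a x * w + (b x - 1)" for x
  have "c x < w * n" if x: "x \<in> pverts G" for x
  proof -
    have "Suc (a x) \<le> n" using a(1) x by auto
    then have "Suc (a x) * w \<le> n * w" by (rule mult_le_mono1)
    then have "w + a x * w \<le> w * n" by (simp add: mult.commute)
    moreover have "b x - 1 < w" using b_bounds[OF x] by linarith
    ultimately show ?thesis unfolding c_def by linarith
  qed
  moreover have "c x \<noteq> c y"
    if xy: "x \<in> pverts G" "y \<in> pverts G" "(x, y) \<in> parcs G" "pos y < pos x" for x y
  proof
    assume eq: "c x = c y"
    have div: "c z div w = a z" "c z mod w = b z - 1" if "z \<in> pverts G" for z
    proof -
      have "b z - 1 < w" using b_bounds[OF that] by linarith
      then show "c z div w = a z" "c z mod w = b z - 1" unfolding c_def by simp_all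
    qed
    have "a x = a y" "b x - 1 = b y - 1" using div xy eq by metis+
    then have "(x, y) \<in> ?M" "b x = b y"
      using xy b_bounds[OF xy(1)] b_bounds[OF xy(2)] by (auto simp: mono_arcs_def)
    then show False using b_less xy by fastforce
  qed
  ultimately show ?thesis by (intro exI[of _ c]) auto
qed

section \<open>Substitution preserves boundedness of the dichromatic number\<close>

text \<open>
  Common core of both statements: \<open>k\<close> has to work only for members of the class with an
  ordering whose backedge graph has clique number at most that of \<open>D\<close>, and it may therefore depend
  on the clique number of \<open>D\<close>.
\<close>

lemma subst_closure_dichromatic_number:
  assumes cls: "digraph_class \<D>"
    and quotient: "\<And>H pos. H \<in> \<D> \<Longrightarrow> inj_on pos (pverts H) \<Longrightarrow>
      back_cliques_le (parcs H) pos (pverts H) (digraph_clique_number D) \<Longrightarrow>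
       \<exists>c. c ` pverts H \<subseteq> {..<k} \<and>
         (\<forall>x\<in>pverts H. \<forall>y\<in>pverts H. (x, y) \<in> parcs H \<longrightarrow> pos y < pos x \<longrightarrow> c x \<noteq> c y)"
    and D: "D \<in> subst_closure \<D>"
  shows "dichromatic_number D \<le> (2 * k) ^ digraph_clique_number D"
proof -
  have "finite (pverts H)" if "H \<in> \<D>" for H
  proof -
    interpret oriented_digraph H using cls that unfolding digraph_class_def by blast
    show ?thesis by (rule pair_finite_verts)
  qed
  then have fin: "finite (pverts D)" using finite_subst_closure D by blast
  obtain pos :: "'a \<Rightarrow> nat" where pos: "inj_on pos (pverts D)"
    "back_cliques_le (parcs D) pos (pverts D) (digraph_clique_number D)"
    using digraph_clique_number_attained[OF fin] by blast
  have "dicolorable (parcs D) (pverts D) ((2 * k) ^ digraph_clique_number D)"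
  proof (rule decomposable_imp_dicolorable[OF _ subst_closure_decomposable[OF cls D] fin pos(1) order_refl pos(2)])
    fix T assume T: "restr (parcs D) T \<in> \<D>" "inj_on pos T"
      "back_cliques_le (parcs D) pos T (digraph_clique_number D)"
    have "back_cliques_le (parcs D \<inter> T \<times> T) pos T (digraph_clique_number D)"
      using T(3) unfolding back_cliques_le_def back_clique_def by blast
    then show "\<exists>c. c ` T \<subseteq> {..<k} \<and>
        (\<forall>x\<in>T. \<forall>y\<in>T. (x, y) \<in> parcs D \<longrightarrow> pos y < pos x \<longrightarrow> c x \<noteq> c y)"
      using quotient[OF T(1), of pos] T(2) by (simp add: restr_def)
  qed
  then show ?thesis by (rule dichromatic_number_le)
qed

lemma mono_on_power_self:
  fixes h :: "nat \<Rightarrow> nat"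
  assumes "mono_on {1..} h"
  shows "mono_on {1..} (\<lambda>w. h w ^ w)"
proof (rule mono_onI)
  fix v w :: nat assume vw: "v \<in> {1..}" "w \<in> {1..}" "v \<le> w"
  then have h: "h v \<le> h w" by (rule mono_onD[OF assms])
  show "h v ^ v \<le> h w ^ w"
  proof (cases "h v = 0")
    case True
    then show ?thesis using vw by (simp add: power_0_left)
  next
    case False
    have "h v ^ v \<le> h w ^ v" using h by (rule power_mono) simp
    also have "\<dots> \<le> h w ^ w" using False h vw by (intro power_increasing) auto
    finally show ?thesis .
  qed
qed

theorem theorem3p9:
  fixes \<D> :: "'a::infinite pair_pre_digraph set"
  assumes "digraph_class \<D>"
  shows "(\<forall>f :: nat \<Rightarrow> nat.
            (\<forall>D\<in>\<D>. tournament D) \<longrightarrow> dichi_bounded_by \<D> f \<longrightarrow>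
            dichi_bounded_by (subst_closure \<D>) (\<lambda>w. (3 * w * f w) ^ w)) \<and>
         (\<forall>K :: nat.
            (\<forall>D\<in>\<D>. chromatic_number (pverts D) (underlying_edges D) \<le> K) \<longrightarrow>
            dichi_bounded_by (subst_closure \<D>) (\<lambda>w. (3 * K) ^ w))"
proof (intro conjI allI impI)
  fix f :: "nat \<Rightarrow> nat"
  assume tour: "\<forall>D\<in>\<D>. tournament D" and bdd: "dichi_bounded_by \<D> f"
  have f_mono: "mono_on {1..} f" and f: "\<And>D. D \<in> \<D> \<Longrightarrow> dichromatic_number D \<le> f (digraph_clique_number D)"
    using bdd unfolding dichi_bounded_by_def by auto
  show "dichi_bounded_by (subst_closure \<D>) (\<lambda>w. (3 * w * f w) ^ w)"
    unfolding dichi_bounded_by_def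
  proof
    have "mono_on {1..} (\<lambda>w. 3 * w * f w)"
    proof (rule mono_onI)
      fix v w :: nat assume vw: "v \<in> {1..}" "w \<in> {1..}" "v \<le> w"
      then have "f v \<le> f w" by (rule mono_onD[OF f_mono])
      then show "3 * v * f v \<le> 3 * w * f w" using vw(3) by (intro mult_le_mono) auto
    qed
    then show "mono_on {1..} (\<lambda>w. (3 * w * f w) ^ w)" by (rule mono_on_power_self)
    show "\<forall>D\<in>subst_closure \<D>. dichromatic_number D
        \<le> (3 * digraph_clique_number D * f (digraph_clique_number D)) ^ digraph_clique_number D"
    proof
      fix D assume D: "D \<in> subst_closure \<D>"
      let ?w = "digraph_clique_number D"
      have "dichromatic_number D \<le> (2 * (?w * f ?w)) ^ ?w"
      proof (rule subst_closure_dichromatic_number[OF assms _ D])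
        fix H and pos :: "'a \<Rightarrow> nat"
        assume H: "H \<in> \<D>" "inj_on pos (pverts H)" "back_cliques_le (parcs H) pos (pverts H) ?w"
        then interpret tournament H using tour by blast
        show "\<exists>c. c ` pverts H \<subseteq> {..<?w * f ?w} \<and>
            (\<forall>x\<in>pverts H. \<forall>y\<in>pverts H. (x, y) \<in> parcs H \<longrightarrow> pos y < pos x \<longrightarrow> c x \<noteq> c y)"
        proof (cases "pverts H = {}")
          case True
          then show ?thesis by simp
        next
          case False
          have "1 \<le> digraph_clique_number H" "digraph_clique_number H \<le> ?w"
            using digraph_clique_number_pos[OF pair_finite_verts False]
              digraph_clique_number_le[OF pair_finite_verts H(2,3)] by auto
          then have "f (digraph_clique_number H) \<le> f ?w" by (intro mono_onD[OF f_mono]) auto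
          then have "dichromatic_number H \<le> f ?w" using f[OF H(1)] by simp
          then have "dicolorable (parcs H) (pverts H) (f ?w)"
            by (rule dicolorable_mono[OF dicolorable_dichromatic_number])
          then show ?thesis by (rule acyclic_coloring_refinement[OF H(2,3)])
        qed
      qed
      also have "\<dots> \<le> (3 * ?w * f ?w) ^ ?w" by (rule power_mono) auto
      finally show "dichromatic_number D \<le> (3 * ?w * f ?w) ^ ?w" .
    qed
  qed
next
  fix K :: nat
  assume chi: "\<forall>D\<in>\<D>. chromatic_number (pverts D) (underlying_edges D) \<le> K"
  show "dichi_bounded_by (subst_closure \<D>) (\<lambda>w. (3 * K) ^ w)"
    unfolding dichi_bounded_by_def
  proof
    show "mono_on {1..} (\<lambda>w. (3 * K) ^ w)" by (rule mono_on_power_self) (simp add: mono_onI)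
    show "\<forall>D\<in>subst_closure \<D>. dichromatic_number D \<le> (3 * K) ^ digraph_clique_number D"
    proof
      fix D assume D: "D \<in> subst_closure \<D>"
      have "dichromatic_number D \<le> (2 * K) ^ digraph_clique_number D"
      proof (rule subst_closure_dichromatic_number[OF assms _ D])
        fix H and pos :: "'a \<Rightarrow> nat"
        assume H: "H \<in> \<D>"
        then interpret oriented_digraph H using assms unfolding digraph_class_def by blast
        have "chromatic_number (pverts H) (underlying_edges H) \<le> K" using chi H by blast
        from chromatic_number_coloring[OF this]
        obtain c where c: "c ` pverts H \<subseteq> {..<K} \<and>
          (\<forall>x\<in>pverts H. \<forall>y\<in>pverts H. (x, y) \<in> parcs H \<longrightarrow> c x \<noteq> c y)" by (rule exE)
        show "\<exists>c. c ` pverts H \<subseteq> {..<K} \<and>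
            (\<forall>x\<in>pverts H. \<forall>y\<in>pverts H. (x, y) \<in> parcs H \<longrightarrow> pos y < pos x \<longrightarrow> c x \<noteq> c y)"
          by (rule exI[of _ c]) (use c in simp)
      qed
      also have "\<dots> \<le> (3 * K) ^ digraph_clique_number D" by (rule power_mono) auto
      finally show "dichromatic_number D \<le> (3 * K) ^ digraph_clique_number D" .
    qed
  qed
qed

end
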